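(* Assume that there exist weights $w_M(\gamma)$, one for each map $M$, such that (i) $w_M(\gamma)$ is a polynomial in $\gamma$ with non-negative rational coefficients, of degree at most $d(M):=2(\text{number of connected components of }M)-\chi(M)$ with $\chi(M)=|V(M)|-|\mathcal{E}(M)|+|F(M)|$, and $w_M$ is even (resp. odd) iff $\chi(M)$ is even (resp. odd); and (ii) for every Young diagram $\lambda$, partition $\pi$ and $\alpha>0$, \[\mathrm{Ch}_\pi^{(\alpha)}(\lambda)=(-1)^{\ell(\pi)}\sum_M\left(-\frac{1}{\sqrt\alpha}\right)^{|V_\bullet(M)|}(\sqrt\alpha)^{|V_\circ(M)|}\,w_M\!\left(\frac{1-\alpha}{\sqrt\alpha}\right)N_M(\lambda),\] the sum running over maps of face-type $\pi$. Then $(-1)^{|\pi|}\mathrm{Ch}^{(\alpha)}_\pi(P \times Q)$ is a polynomial in the variables $(P/\sqrt{\alpha},-\sqrt{\alpha}Q,-\gamma)$, where $\gamma=\frac{1-\alpha}{\sqrt\alpha}$, with non-negative rational coefficients.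
   Context: Multirectangular diagrams: for sequences $P=(p_1,\dots,p_\ell)$, $Q=(q_1,\dots,q_\ell)$ of non-negative integers with $q_1\ge\dots\ge q_\ell$, $P\times Q$ is the Young diagram with $p_1$ rows of length $q_1$, ..., $p_\ell$ rows of length $q_\ell$. Jack characters: with $J^{(\alpha)}_\lambda$ the Jack symmetric function in Macdonald's $J$-normalization, write $J_\lambda^{(\alpha)}=\sum_{|\rho|=|\lambda|}\theta_{\rho}^{(\alpha)}(\lambda)\,p_{\rho}$ and set $\mathrm{Ch}_{\pi}^{(\alpha)}(\lambda)=\alpha^{-\frac{|\pi|-\ell(\pi)}{2}}\binom{|\lambda|-|\pi|+m_1(\pi)}{m_1(\pi)}\,z_\pi\,\theta^{(\alpha)}_{\pi \cup 1^{|\lambda|-|\pi|}}(\lambda)$, where $z_\pi=\pi_1\pi_2\cdots m_1(\pi)!m_2(\pi)!\cdots$ and $m_i(\pi)$ is the multiplicity of $i$ in $\pi$. Maps: a map is a triple $M=(\mathcal{B},\mathcal{W},\mathcal{E})$ of pairings of a finite set $S$. For pairings $P,P'$ of $S$, $\mathcal{L}(P,P')$ is the bipartite graph with vertices the pairs of $P$ and $P'$ and edges the elements of $S$; it is a union of polygons of lengths $2\ell_1\ge2\ell_2\ge\cdots$, and $(\ell_1,\ell_2,\dots)$ is the type of $(P,P')$. Faces $F(M)$ are polygons of $\mathcal{L}(\mathcal{B},\mathcal{W})$ and the face-type of $M$ is the type of $(\mathcal{B},\mathcal{W})$ (summing over maps of face-type $\pi$: fix $(\mathcal{B},\mathcal{W})$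 of type $\pi$, sum over all pairings $\mathcal{E}$). Black (resp. white) vertices $V_\bullet(M)$ (resp. $V_\circ(M)$) are polygons of $\mathcal{L}(\mathcal{B},\mathcal{E})$ (resp. $\mathcal{L}(\mathcal{W},\mathcal{E})$), $V(M)=V_\bullet\sqcup V_\circ$; edges $\mathcal{E}(M)$ are the pairs of $\mathcal{E}$; connected components are classes of the equivalence generated by being partners in any of the three pairings. For a bipartite graph $G$, $N_G(\lambda)$ is the number of maps sending white vertices to columns of $\lambda$, black vertices to rows, edges to boxes, compatibly with incidence; $N_M:=N_G$ for the underlying graph of $M$. *)

theory Defs
  imports
    Complex_Main
    "HOL-Library.Multiset"
    "HOL-Library.FuncSet"
    "HOL-Library.Disjoint_Sets"
    "HOL-Library.Poly_Mapping"
    "HOL-Computational_Algebra.Polynomial"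
begin

section \<open>Partitions and Young diagrams\<close>

text \<open>A partition (equivalently, a Young diagram) is the list of its parts (row lengths), weakly
  decreasing and positive; thus \<^term>\<open>sum_list \<nu>\<close> is its size, \<^term>\<open>length \<nu>\<close> its number of parts and
  \<^term>\<open>count_list \<nu> i\<close> the multiplicity of the part \<^term>\<open>i\<close>.\<close>

definition is_partition :: "nat list \<Rightarrow> bool" where
  "is_partition \<nu> \<longleftrightarrow> sorted_wrt (\<ge>) \<nu> \<and> 0 \<notin> set \<nu>"

definition zee :: "nat list \<Rightarrow> nat" where
  "zee \<pi> = prod_list \<pi> * (\<Prod>i\<in>set \<pi>. fact (count_list \<pi> i))"

definition strictly_dominated :: "nat list \<Rightarrow> nat list \<Rightarrow> bool" where
  "strictly_dominated \<mu> \<nu> \<longleftrightarrow>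
     \<mu> \<noteq> \<nu> \<and> sum_list \<mu> = sum_list \<nu> \<and> (\<forall>i. sum_list (take i \<mu>) \<le> sum_list (take i \<nu>))"

text \<open>Boxes are pairs (row, column), both counted from 0.\<close>

definition rows :: "nat list \<Rightarrow> nat set" where
  "rows \<nu> = {..<length \<nu>}"

definition boxes :: "nat list \<Rightarrow> (nat \<times> nat) set" where
  "boxes \<nu> = {(i, j). i < length \<nu> \<and> j < \<nu> ! i}"

definition columns :: "nat list \<Rightarrow> nat set" where
  "columns \<nu> = {j. \<exists>i. (i, j) \<in> boxes \<nu>}"

definition arm :: "nat list \<Rightarrow> nat \<Rightarrow> nat \<Rightarrow> nat" where
  "arm \<nu> i j = card {j'. j < j' \<and> (i, j') \<in> boxes \<nu>}"

definition leg :: "nat list \<Rightarrow> nat \<Rightarrow> nat \<Rightarrow> nat" where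
  "leg \<nu> i j = card {i'. i < i' \<and> (i', j) \<in> boxes \<nu>}"

text \<open>Rows of length 0 are dropped.\<close>

definition multirect :: "nat list \<Rightarrow> nat list \<Rightarrow> nat list" where
  "multirect P Q = filter (\<lambda>r. 0 < r) (concat (map2 replicate P Q))"


section \<open>Symmetric functions\<close>

text \<open>A formal power series in the variables $x_0, x_1, \ldots$ is given by its coefficients; a
  monomial is a finitely supported exponent vector. The symmetric functions used here are finite
  linear combinations of the monomial (or power-sum) symmetric functions below.\<close>

type_synonym series = "(nat \<Rightarrow>\<^sub>0 nat) \<Rightarrow> real"

definition series_one :: series where
  "series_one = (\<lambda>m. if m = 0 then 1 else 0)"

text \<open>The index set of the sum is finite for every monomial.\<close>

definition series_mult :: "series \<Rightarrow> series \<Rightarrow> series" where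
  "series_mult f g = (\<lambda>m. \<Sum>(a, b)\<in>{(a, b). a + b = m}. f a * g b)"

definition power_sum :: "nat \<Rightarrow> series" where
  "power_sum k = (\<lambda>m. if \<exists>i. m = Poly_Mapping.single i k then 1 else 0)"

definition power_sum_partition :: "nat list \<Rightarrow> series" where
  "power_sum_partition \<rho> = foldr (\<lambda>k f. series_mult (power_sum k) f) \<rho> series_one"

definition monomial_sym :: "nat list \<Rightarrow> series" where
  "monomial_sym \<nu> = (\<lambda>m.
     if image_mset (Poly_Mapping.lookup m) (mset_set (Poly_Mapping.keys m)) = mset \<nu> then 1 else 0)"

definition power_sum_expansion :: "series \<Rightarrow> (nat list \<Rightarrow> real) \<Rightarrow> bool" where
  "power_sum_expansion f \<theta> \<longleftrightarrow>
     finite {\<rho>. \<theta> \<rho> \<noteq> 0} \<and> (\<forall>\<rho>. \<theta> \<rho> \<noteq> 0 \<longrightarrow> is_partition \<rho>) \<and>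
     f = (\<lambda>m. \<Sum>\<rho> | \<theta> \<rho> \<noteq> 0. \<theta> \<rho> * power_sum_partition \<rho> m)"

text \<open>The power sums are a linear basis of the real symmetric functions, so the expansion exists
  and is unique.\<close>

definition power_sum_coeff :: "series \<Rightarrow> nat list \<Rightarrow> real" where
  "power_sum_coeff f = (THE \<theta>. power_sum_expansion f \<theta>)"

text \<open>The deformed Hall scalar product, with
  $\langle p_\rho, p_\sigma\rangle = \delta_{\rho\sigma}\, z_\rho\, \alpha^{\ell(\rho)}$.\<close>

definition jack_scalar :: "real \<Rightarrow> series \<Rightarrow> series \<Rightarrow> real" where
  "jack_scalar \<alpha> f g =
     (\<Sum>\<rho> | power_sum_coeff f \<rho> \<noteq> 0.
        power_sum_coeff f \<rho> * power_sum_coeff g \<rho> * real (zee \<rho>) * \<alpha> ^ length \<rho>)"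


section \<open>Jack symmetric functions and Jack characters\<close>

text \<open>Macdonald's characterization of the family $P^{(\alpha)}_\nu$: unitriangular in the
  monomial basis for the dominance order, and pairwise orthogonal. For positive \<^term>\<open>\<alpha>\<close> there is
  exactly one such family; the value 0 off partitions only serves to make it unique as a
  function.\<close>

definition is_jack_P_family :: "real \<Rightarrow> (nat list \<Rightarrow> series) \<Rightarrow> bool" where
  "is_jack_P_family \<alpha> P \<longleftrightarrow>
     (\<forall>\<nu>. \<not> is_partition \<nu> \<longrightarrow> P \<nu> = (\<lambda>m. 0)) \<and>
     (\<forall>\<nu>. is_partition \<nu> \<longrightarrow>
        (\<exists>u. P \<nu> = (\<lambda>m. monomial_sym \<nu> m +
           (\<Sum>\<mu> | is_partition \<mu> \<and> strictly_dominated \<mu> \<nu>. u \<mu> * monomial_sym \<mu> m)))) \<and>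
     (\<forall>\<nu> \<mu>. is_partition \<nu> \<longrightarrow> is_partition \<mu> \<longrightarrow> \<nu> \<noteq> \<mu> \<longrightarrow> jack_scalar \<alpha> (P \<nu>) (P \<mu>) = 0)"

definition jack_P :: "real \<Rightarrow> nat list \<Rightarrow> series" where
  "jack_P \<alpha> = (THE P. is_jack_P_family \<alpha> P)"

text \<open>The $J$-normalization: $J_\nu = \prod_{s\in\nu} (\alpha\, a(s) + l(s) + 1)\, P_\nu$
  with arm and leg lengths $a(s)$, $l(s)$.\<close>

definition jack_J :: "real \<Rightarrow> nat list \<Rightarrow> series" where
  "jack_J \<alpha> \<nu> =
     (\<lambda>m. (\<Prod>(i, j)\<in>boxes \<nu>. \<alpha> * real (arm \<nu> i j) + real (leg \<nu> i j) + 1) * jack_P \<alpha> \<nu> m)"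

definition jack_theta :: "real \<Rightarrow> nat list \<Rightarrow> nat list \<Rightarrow> real" where
  "jack_theta \<alpha> \<rho> \<nu> = power_sum_coeff (jack_J \<alpha> \<nu>) \<rho>"

text \<open>For \<^prop>\<open>sum_list \<nu> < sum_list \<pi>\<close> there is no partition $\pi \cup 1^{|\nu|-|\pi|}$ and the
  character is 0 by convention. The list below is sorted because 1 is the smallest part.\<close>

definition jack_character :: "real \<Rightarrow> nat list \<Rightarrow> nat list \<Rightarrow> real" where
  "jack_character \<alpha> \<pi> \<nu> =
     (if sum_list \<nu> < sum_list \<pi> then 0
      else \<alpha> powr (- ((real (sum_list \<pi>) - real (length \<pi>)) / 2))
         * real ((sum_list \<nu> - sum_list \<pi> + count_list \<pi> 1) choose count_list \<pi> 1)
         * real (zee \<pi>)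
         * jack_theta \<alpha> (\<pi> @ replicate (sum_list \<nu> - sum_list \<pi>) 1) \<nu>)"


section \<open>Maps\<close>

definition pairing_on :: "'s set \<Rightarrow> 's set set \<Rightarrow> bool" where
  "pairing_on S P \<longleftrightarrow> partition_on S P \<and> (\<forall>p\<in>P. card p = 2)"

text \<open>The classes of the equivalence relation generated by lying in a common pair; on the union of
  the pairs the relation is already reflexive and symmetric.\<close>

definition pair_classes :: "'s set set \<Rightarrow> 's set set" where
  "pair_classes \<P> = (\<Union>\<P>) // {(s, t). \<exists>p\<in>\<P>. s \<in> p \<and> t \<in> p}\<^sup>+"

text \<open>The edges of the graph $\mathcal{L}(P, P')$ are the elements of the ground set, and two of
  them meet in a vertex iff they lie in a common pair of $P$ or of $P'$. A polygon is represented by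
  the set of its edges, so its length is its cardinality.\<close>

definition polygons :: "'s set set \<Rightarrow> 's set set \<Rightarrow> 's set set" where
  "polygons P P' = pair_classes (P \<union> P')"

definition pairings_type :: "'s set set \<Rightarrow> 's set set \<Rightarrow> nat list" where
  "pairings_type P P' =
     rev (sorted_list_of_multiset (image_mset (\<lambda>c. card c div 2) (mset_set (polygons P P'))))"

text \<open>Triples of black, white and edge pairings.\<close>

type_synonym 's pmap = "'s set set \<times> 's set set \<times> 's set set"

fun is_map :: "'s pmap \<Rightarrow> bool" where
  "is_map (B, W, E) \<longleftrightarrow> (\<exists>S. finite S \<and> pairing_on S B \<and> pairing_on S W \<and> pairing_on S E)"

fun faces :: "'s pmap \<Rightarrow> 's set set" where
  "faces (B, W, E) = polygons B W"

fun black_vertices :: "'s pmap \<Rightarrow> 's set set" where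
  "black_vertices (B, W, E) = polygons B E"

fun white_vertices :: "'s pmap \<Rightarrow> 's set set" where
  "white_vertices (B, W, E) = polygons W E"

fun edges :: "'s pmap \<Rightarrow> 's set set" where
  "edges (B, W, E) = E"

fun connected_comps :: "'s pmap \<Rightarrow> 's set set" where
  "connected_comps (B, W, E) = pair_classes (B \<union> W \<union> E)"

definition euler_char :: "'s pmap \<Rightarrow> int" where
  "euler_char M =
     int (card (black_vertices M) + card (white_vertices M)) - int (card (edges M))
       + int (card (faces M))"

definition map_d :: "'s pmap \<Rightarrow> int" where
  "map_d M = 2 * int (card (connected_comps M)) - euler_char M"

text \<open>Embeddings of a bipartite graph (black vertices, white vertices, edges, incidence) into a Young
  diagram: incident vertex and edge go to a row or column and a box contained in it.\<close>

definition graph_embeddings ::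
  "'v set \<Rightarrow> 'w set \<Rightarrow> 'e set \<Rightarrow> ('e \<Rightarrow> 'v \<Rightarrow> bool) \<Rightarrow> ('e \<Rightarrow> 'w \<Rightarrow> bool) \<Rightarrow> nat list
    \<Rightarrow> (('v \<Rightarrow> nat) \<times> ('w \<Rightarrow> nat) \<times> ('e \<Rightarrow> nat \<times> nat)) set" where
  "graph_embeddings Vb Vw Es incb incw \<nu> =
     {(r, c, b). r \<in> Vb \<rightarrow>\<^sub>E rows \<nu> \<and> c \<in> Vw \<rightarrow>\<^sub>E columns \<nu> \<and> b \<in> Es \<rightarrow>\<^sub>E boxes \<nu> \<and>
        (\<forall>e\<in>Es. \<forall>v\<in>Vb. incb e v \<longrightarrow> fst (b e) = r v) \<and>
        (\<forall>e\<in>Es. \<forall>v\<in>Vw. incw e v \<longrightarrow> snd (b e) = c v)}"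

text \<open>Since polygons are sets of elements of the ground set, an edge of the map is incident to the
  vertices that contain it.\<close>

definition N_map :: "'s pmap \<Rightarrow> nat list \<Rightarrow> nat" where
  "N_map M \<nu> = card (graph_embeddings (black_vertices M) (white_vertices M) (edges M) (\<subseteq>) (\<subseteq>) \<nu>)"


section \<open>Weights and the conjectural formula\<close>

definition even_poly :: "rat poly \<Rightarrow> bool" where
  "even_poly p \<longleftrightarrow> pcompose p [:0, - 1:] = p"

definition odd_poly :: "rat poly \<Rightarrow> bool" where
  "odd_poly p \<longleftrightarrow> pcompose p [:0, - 1:] = - p"

definition admissible_weight :: "'s pmap \<Rightarrow> rat poly \<Rightarrow> bool" where
  "admissible_weight M p \<longleftrightarrow>
     (\<forall>i. 0 \<le> coeff p i) \<and> int (degree p) \<le> map_d M \<and>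
     (even_poly p \<longleftrightarrow> even (euler_char M)) \<and> (odd_poly p \<longleftrightarrow> odd (euler_char M))"

definition weighted_map_sum ::
  "('s pmap \<Rightarrow> rat poly) \<Rightarrow> 's set set \<Rightarrow> 's set set \<Rightarrow> real \<Rightarrow> nat list \<Rightarrow> real" where
  "weighted_map_sum w B W \<alpha> \<nu> =
     (\<Sum>E | pairing_on (\<Union>B) E.
        (- (1 / sqrt \<alpha>)) ^ card (black_vertices (B, W, E))
        * sqrt \<alpha> ^ card (white_vertices (B, W, E))
        * poly (map_poly of_rat (w (B, W, E))) ((1 - \<alpha>) / sqrt \<alpha>)
        * real (N_map (B, W, E) \<nu>))"


section \<open>Polynomials in the variables of the multirectangular coordinates\<close>

datatype mvar = VarP nat | VarQ nat | VarG

type_synonym mpoly_rat = "(mvar \<Rightarrow>\<^sub>0 nat) \<Rightarrow>\<^sub>0 rat"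

definition mpoly_vars :: "mpoly_rat \<Rightarrow> mvar set" where
  "mpoly_vars R = (\<Union>m\<in>Poly_Mapping.keys R. Poly_Mapping.keys m)"

definition mpoly_eval :: "(mvar \<Rightarrow> real) \<Rightarrow> mpoly_rat \<Rightarrow> real" where
  "mpoly_eval x R =
     (\<Sum>m\<in>Poly_Mapping.keys R. of_rat (Poly_Mapping.lookup R m) *
        (\<Prod>v\<in>Poly_Mapping.keys m. x v ^ Poly_Mapping.lookup m v))"

fun rescaled_coords :: "real \<Rightarrow> nat list \<Rightarrow> nat list \<Rightarrow> mvar \<Rightarrow> real" where
  "rescaled_coords \<alpha> P Q (VarP i) = real (P ! i) / sqrt \<alpha>"
| "rescaled_coords \<alpha> P Q (VarQ i) = - sqrt \<alpha> * real (Q ! i)"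
| "rescaled_coords \<alpha> P Q VarG = - ((1 - \<alpha>) / sqrt \<alpha>)"

end

theory Submission
  imports Defs
begin

text \<open>Sorting the rows of $P \times Q$ into blocks gives
  $N_M(P \times Q) = \sum_f \prod_{v \in V_\bullet} p_{f(v)} \prod_{u \in V_\circ} q_{m(u)}$, where
  $f$ assigns a block to every black vertex and $m(u)$ is the largest block adjacent to $u$.
  Rewriting this in terms of $p_i/\sqrt\alpha$ and $-\sqrt\alpha\, q_i$ absorbs all powers of
  $\sqrt\alpha$ and leaves the sign $(-1)^{|V(M)|}$; passing from $\gamma$ to $-\gamma$ in $w_M$
  contributes $(-1)^{\chi(M)}$. As $M$ has $|\pi|$ edges and $\ell(\pi)$ faces,
  $\chi(M) = |V(M)| - |\pi| + \ell(\pi)$, so these signs cancel against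
  $(-1)^{|\pi|+\ell(\pi)}$.\<close>

section \<open>Evaluation of monomials and polynomials\<close>

definition monomial_eval :: "(mvar \<Rightarrow> real) \<Rightarrow> (mvar \<Rightarrow>\<^sub>0 nat) \<Rightarrow> real" where
  "monomial_eval x m = (\<Prod>v\<in>Poly_Mapping.keys m. x v ^ Poly_Mapping.lookup m v)"

text \<open>Variables outside the support have exponent 0 and contribute the factor 1. Two monomials
  with different supports can thus be evaluated over a common set of variables.\<close>

lemma monomial_eval_superset:
  assumes "finite A" "Poly_Mapping.keys m \<subseteq> A"
  shows "monomial_eval x m = (\<Prod>v\<in>A. x v ^ Poly_Mapping.lookup m v)"
  unfolding monomial_eval_def
  by (rule prod.mono_neutral_left) (use assms in \<open>auto simp: in_keys_iff\<close>)

lemma monomial_eval_add: "monomial_eval x (m + n) = monomial_eval x m * monomial_eval x n"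
proof -
  let ?A = "Poly_Mapping.keys m \<union> Poly_Mapping.keys n"
  have "Poly_Mapping.keys (m + n) \<subseteq> ?A"
    by (rule keys_add)
  then show ?thesis
    by (simp add: monomial_eval_superset[of ?A] lookup_add power_add prod.distrib)
qed

lemma monomial_eval_zero [simp]: "monomial_eval x 0 = 1"
  by (simp add: monomial_eval_def)

lemma monomial_eval_single [simp]: "monomial_eval x (Poly_Mapping.single v k) = x v ^ k"
  by (simp add: monomial_eval_superset[of "{v}"])

lemma monomial_eval_sum:
  "finite I \<Longrightarrow> monomial_eval x (\<Sum>i\<in>I. m i) = (\<Prod>i\<in>I. monomial_eval x (m i))"
  by (induction I rule: finite_induct) (auto simp: monomial_eval_add)

lemma mpoly_eval_superset:
  assumes "finite A" "Poly_Mapping.keys R \<subseteq> A"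
  shows "mpoly_eval x R = (\<Sum>m\<in>A. of_rat (Poly_Mapping.lookup R m) * monomial_eval x m)"
  unfolding mpoly_eval_def monomial_eval_def
  by (rule sum.mono_neutral_left) (use assms in \<open>auto simp: in_keys_iff\<close>)

lemma mpoly_eval_add: "mpoly_eval x (R + R') = mpoly_eval x R + mpoly_eval x R'"
proof -
  let ?A = "Poly_Mapping.keys R \<union> Poly_Mapping.keys R'"
  have "Poly_Mapping.keys (R + R') \<subseteq> ?A"
    by (rule keys_add)
  then show ?thesis
    by (simp add: mpoly_eval_superset[of ?A] lookup_add of_rat_add distrib_right sum.distrib)
qed

lemma mpoly_eval_single: "mpoly_eval x (Poly_Mapping.single m c) = of_rat c * monomial_eval x m"
  by (simp add: mpoly_eval_superset[of "{m}"])

section \<open>Polynomial functions with non-negative coefficients\<close>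

text \<open>Speaking of the function \<open>g\<close> instead of the polynomial spares every product
  of polynomials: it is enough to write \<open>g\<close> as a sum of monomials with coefficients
  that are not negative.\<close>

definition nonneg_mpoly_fun :: "mvar set \<Rightarrow> ((mvar \<Rightarrow> real) \<Rightarrow> real) \<Rightarrow> bool" where
  "nonneg_mpoly_fun V g \<longleftrightarrow> (\<exists>R :: mpoly_rat.
     (\<forall>m. 0 \<le> Poly_Mapping.lookup R m) \<and> mpoly_vars R \<subseteq> V \<and> (\<forall>x. mpoly_eval x R = g x))"

lemma nonneg_mpoly_fun_monomial:
  assumes "0 \<le> c" "Poly_Mapping.keys m \<subseteq> V"
  shows "nonneg_mpoly_fun V (\<lambda>x. of_rat c * monomial_eval x m)"
  unfolding nonneg_mpoly_fun_def
  by (rule exI[of _ "Poly_Mapping.single m c"])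
    (use assms in \<open>auto simp: mpoly_eval_single mpoly_vars_def lookup_single when_def split: if_splits\<close>)

lemma nonneg_mpoly_fun_zero: "nonneg_mpoly_fun V (\<lambda>x. 0)"
  unfolding nonneg_mpoly_fun_def by (rule exI[of _ 0]) (auto simp: mpoly_eval_def mpoly_vars_def)

lemma nonneg_mpoly_fun_add:
  assumes "nonneg_mpoly_fun V g" "nonneg_mpoly_fun V h"
  shows "nonneg_mpoly_fun V (\<lambda>x. g x + h x)"
proof -
  obtain R R' :: mpoly_rat
    where R: "\<forall>m. 0 \<le> Poly_Mapping.lookup R m" "mpoly_vars R \<subseteq> V" "\<forall>x. mpoly_eval x R = g x"
      and R': "\<forall>m. 0 \<le> Poly_Mapping.lookup R' m" "mpoly_vars R' \<subseteq> V" "\<forall>x. mpoly_eval x R' = h x"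
    using assms unfolding nonneg_mpoly_fun_def by blast
  have "mpoly_vars (R + R') \<subseteq> V"
    using R(2) R'(2) keys_add[of R R'] unfolding mpoly_vars_def by blast
  with R R' show ?thesis
    unfolding nonneg_mpoly_fun_def
    by (intro exI[of _ "R + R'"]) (auto simp: lookup_add mpoly_eval_add)
qed

lemma nonneg_mpoly_fun_sum:
  assumes "\<And>i. i \<in> I \<Longrightarrow> nonneg_mpoly_fun V (g i)"
  shows "nonneg_mpoly_fun V (\<lambda>x. \<Sum>i\<in>I. g i x)"
  using assms
  by (induction I rule: infinite_finite_induct)
    (simp_all add: nonneg_mpoly_fun_zero nonneg_mpoly_fun_add)

section \<open>Parity of the weights and the sign of gamma\<close>

text \<open>Substituting \<open>-x\<close> multiplies the coefficient of index \<open>i\<close> by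
  \<open>(- 1) ^ i\<close>, while the parity of \<open>p\<close> prescribes one common sign. A
  coefficient of the wrong parity would equal its own negative.\<close>

lemma even_odd_poly_coeff:
  assumes "admissible_weight M p" "coeff p i \<noteq> 0"
  shows "even i \<longleftrightarrow> even (euler_char M)"
proof -
  have c: "coeff (pcompose p [:0, - 1:]) i = (- 1) ^ i * coeff p i"
    \<comment> \<open>\<open>[:0, - 1:]\<close> is the monomial of degree 1 with coefficient
      -1.\<close>
    using coeff_pcompose_monom_linear[of p "- 1" i] by (simp add: monom_altdef)
  show ?thesis
  proof (cases "even (euler_char M)")
    case True
    then have "coeff (pcompose p [:0, - 1:]) i = coeff p i"
      using assms(1) by (simp add: admissible_weight_def even_poly_def)
    with c assms(2) True show ?thesis by (cases "even i") auto
  next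
    case False
    then have "coeff (pcompose p [:0, - 1:]) i = - coeff p i"
      using assms(1) by (simp add: admissible_weight_def odd_poly_def)
    with c assms(2) False show ?thesis by (cases "even i") auto
  qed
qed

lemma poly_of_rat_altdef:
  "poly (map_poly of_rat p) (y :: real) = (\<Sum>i\<le>degree p. of_rat (coeff p i) * y ^ i)"
proof -
  have "degree (map_poly (of_rat :: rat \<Rightarrow> real) p) = degree p"
    by (rule degree_map_poly) simp
  then show ?thesis
    by (simp add: poly_altdef coeff_map_poly)
qed

text \<open>All exponents that occur in \<open>p\<close> have the parity of the Euler
  characteristic, so each term picks up the same sign. The exponent \<open>n\<close> is left free up
  to parity, so that it can later be a sum of cardinalities.\<close>

lemma poly_weight_uminus:
  assumes "admissible_weight M p" "even n \<longleftrightarrow> even (euler_char M)"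
  shows "poly (map_poly of_rat p) (- y :: real) = (- 1) ^ n * poly (map_poly of_rat p) y"
proof -
  have "of_rat (coeff p i) * (- y) ^ i = (- 1) ^ n * (of_rat (coeff p i) * y ^ i)" for i
  proof (cases "coeff p i = 0")
    case False
    then have "even i \<longleftrightarrow> even n" using even_odd_poly_coeff assms by blast
    then show ?thesis by (cases "even i") auto
  qed simp
  then show ?thesis
    by (simp only: poly_of_rat_altdef sum_distrib_left)
qed

section \<open>Pairings and their polygons\<close>

lemma equiv_pair_classes:
  "equiv (\<Union>\<P>) ({(s, t). \<exists>p\<in>\<P>. s \<in> p \<and> t \<in> p}\<^sup>+)"
proof (rule equivI)
  let ?r = "{(s, t). \<exists>p\<in>\<P>. s \<in> p \<and> t \<in> p}"
  have "?r \<subseteq> \<Union>\<P> \<times> \<Union>\<P>" by auto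
  then show "?r\<^sup>+ \<subseteq> \<Union>\<P> \<times> \<Union>\<P>" by (rule trancl_subset_Sigma)
  show "refl_on (\<Union>\<P>) (?r\<^sup>+)"
    by (rule refl_onI) auto
  have "sym ?r" by (auto simp: sym_def)
  then show "sym (?r\<^sup>+)" by (rule sym_trancl)
qed simp

lemma partition_on_pair_classes: "partition_on (\<Union>\<P>) (pair_classes \<P>)"
  unfolding pair_classes_def by (rule partition_on_quotient) (rule equiv_pair_classes)

text \<open>The class of any element of \<open>p\<close> contains \<open>p\<close>, since elements
  of one pair are related directly. Two classes that contain \<open>p\<close> meet, hence coincide.
  For maps this gives every edge exactly one black and one white end.\<close>

lemma pair_in_unique_class:
  assumes "p \<in> \<P>" "p \<noteq> {}"
  shows "\<exists>!c. c \<in> pair_classes \<P> \<and> p \<subseteq> c"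
proof -
  let ?r = "{(s, t). \<exists>p\<in>\<P>. s \<in> p \<and> t \<in> p}"
  obtain s where s: "s \<in> p" using assms(2) by auto
  have "?r\<^sup>+ `` {s} \<in> pair_classes \<P>"
    unfolding pair_classes_def by (rule quotientI) (use s assms(1) in auto)
  moreover have "p \<subseteq> ?r\<^sup>+ `` {s}" using s assms(1) by auto
  moreover have "c = c'"
    if "c \<in> pair_classes \<P>" "p \<subseteq> c" "c' \<in> pair_classes \<P>" "p \<subseteq> c'" for c c'
    using disjointD[OF partition_onD2[OF partition_on_pair_classes], of c \<P> c'] that s by blast
  ultimately show ?thesis by blast
qed

lemma pairing_onD:
  assumes "pairing_on S P"
  shows "\<Union>P = S" "disjoint P" "\<And>p. p \<in> P \<Longrightarrow> card p = 2" "\<And>p. p \<in> P \<Longrightarrow> p \<noteq> {}"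
  using assms by (auto simp: pairing_on_def partition_on_def)

lemma finite_pairing_on: "finite S \<Longrightarrow> pairing_on S P \<Longrightarrow> finite P"
  by (auto simp: pairing_on_def intro: finite_elements)

text \<open>In particular, all pairings of one finite set have equally many pairs, which is how
  edges are compared with black pairs.\<close>

lemma card_pairing_on:
  assumes "finite S" "pairing_on S P"
  shows "card S = 2 * card P"
proof -
  have "card (\<Union>P) = sum card P"
  proof (rule card_Union_disjoint)
    show "disjoint P" using assms(2) by (rule pairing_onD)
    show "finite p" if "p \<in> P" for p
      using pairing_onD(3)[OF assms(2) that] by (auto intro: card_ge_0_finite)
  qed
  also have "\<dots> = 2 * card P"
    using pairing_onD(3)[OF assms(2)] by simp
  finally show ?thesis
    using pairing_onD(1)[OF assms(2)] by simp
qed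

lemma partition_on_polygons:
  assumes "pairing_on S P" "pairing_on S P'"
  shows "partition_on S (polygons P P')"
  using partition_on_pair_classes[of "P \<union> P'"] pairing_onD(1)[OF assms(1)] pairing_onD(1)[OF assms(2)]
  by (simp add: polygons_def)

lemma finite_polygons:
  assumes "finite S" "pairing_on S P" "pairing_on S P'"
  shows "finite (polygons P P')"
  using assms partition_on_polygons finite_elements by metis

lemma polygons_commute: "polygons P P' = polygons P' P"
  by (simp add: polygons_def Un_commute)

lemma pair_in_unique_polygon:
  assumes "pairing_on S P" "p \<in> P"
  shows "\<exists>!c. c \<in> polygons P P' \<and> p \<subseteq> c"
  unfolding polygons_def
  by (rule pair_in_unique_class) (use assms pairing_onD(4) in auto)

text \<open>An element of \<open>c\<close> lies in some pair of \<open>P\<close>. The polygon around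
  that pair meets \<open>c\<close>, hence is \<open>c\<close>.\<close>

lemma polygon_eq_Union_pairs:
  assumes "pairing_on S P" "pairing_on S P'" "c \<in> polygons P P'"
  shows "c = \<Union>{p \<in> P. p \<subseteq> c}"
proof
  show "c \<subseteq> \<Union>{p \<in> P. p \<subseteq> c}"
  proof
    fix s assume s: "s \<in> c"
    have part: "partition_on S (polygons P P')" using assms partition_on_polygons by blast
    have "s \<in> S" using s assms(3) partition_onD1[OF part] by auto
    then obtain p where p: "p \<in> P" "s \<in> p" using pairing_onD(1)[OF assms(1)] by auto
    obtain c' where c': "c' \<in> polygons P P'" "p \<subseteq> c'"
      using pair_in_unique_polygon[OF assms(1) p(1)] by blast
    have "c' = c" using disjointD[OF partition_onD2[OF part], of c' c] c' p s assms(3) by blast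
    with p c' show "s \<in> \<Union>{p \<in> P. p \<subseteq> c}" by auto
  qed
qed auto

text \<open>Classes of a partition are nonempty. Applied to the edge pairing, this says that no
  vertex of a map is isolated.\<close>

lemma polygon_has_pair:
  assumes "pairing_on S P" "pairing_on S P'" "c \<in> polygons P P'"
  shows "\<exists>p\<in>P. p \<subseteq> c"
proof -
  have "c \<noteq> {}"
    using partition_onD3[OF partition_on_polygons[OF assms(1,2)]] assms(3) by auto
  then show ?thesis using polygon_eq_Union_pairs[OF assms] by auto
qed

text \<open>The pairs of \<open>P\<close> inside \<open>c\<close> form a pairing of
  \<open>c\<close>. Hence the halving in \<open>pairings_type\<close> is exact.\<close>

lemma card_polygon:
  assumes "finite S" "pairing_on S P" "pairing_on S P'" "c \<in> polygons P P'"
  shows "card c = 2 * card {p \<in> P. p \<subseteq> c}"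
proof (rule card_pairing_on)
  have "c \<subseteq> S"
    using partition_onD1[OF partition_on_polygons[OF assms(2,3)]] assms(4) by auto
  then show "finite c" using assms(1) by (rule finite_subset)
  show "pairing_on c {p \<in> P. p \<subseteq> c}"
    using polygon_eq_Union_pairs[OF assms(2-4)] assms(2)
    by (auto simp: pairing_on_def partition_on_def disjoint_def)
qed

text \<open>Half the length of a polygon counts its pairs from \<open>P\<close>, and every pair of
  \<open>P\<close> lies in exactly one polygon.\<close>

lemma sum_list_pairings_type:
  assumes "finite S" "pairing_on S P" "pairing_on S P'"
  shows "sum_list (pairings_type P P') = card P"
proof -
  have "sum_list (pairings_type P P')
      = sum_mset (image_mset (\<lambda>c. card c div 2) (mset_set (polygons P P')))"
    unfolding pairings_type_def by (metis mset_rev mset_sorted_list_of_multiset sum_mset_sum_list)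
  also have "\<dots> = (\<Sum>c\<in>polygons P P'. card c div 2)"
    by (simp add: sum_unfold_sum_mset)
  also have "\<dots> = (\<Sum>c\<in>polygons P P'. card {p \<in> P. p \<subseteq> c})"
    using card_polygon[OF assms] by simp
  also have "\<dots> = card (\<Union>c\<in>polygons P P'. {p \<in> P. p \<subseteq> c})"
  proof (rule card_UN_disjoint[symmetric])
    show "finite (polygons P P')" using assms by (rule finite_polygons)
    show "\<forall>c\<in>polygons P P'. finite {p \<in> P. p \<subseteq> c}" using finite_pairing_on[OF assms(1,2)] by auto
    show "\<forall>c\<in>polygons P P'. \<forall>c'\<in>polygons P P'. c \<noteq> c' \<longrightarrow>
        {p \<in> P. p \<subseteq> c} \<inter> {p \<in> P. p \<subseteq> c'} = {}"
      using pair_in_unique_polygon[OF assms(2), of _ P'] by auto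
  qed
  also have "(\<Union>c\<in>polygons P P'. {p \<in> P. p \<subseteq> c}) = P"
    using ex1_implies_ex[OF pair_in_unique_polygon[OF assms(2), of _ P']] by auto
  finally show ?thesis .
qed

text \<open>For the black and white pairings this is the number of faces of the map.\<close>

lemma length_pairings_type: "length (pairings_type P P') = card (polygons P P')"
  unfolding pairings_type_def
  by (metis length_rev mset_sorted_list_of_multiset size_image_mset size_mset size_mset_set)

section \<open>Embeddings of bipartite graphs\<close>

text \<open>The box of an edge is forced by the row of its black end and the column of its white
  end. Once the rows are chosen, the columns of different white vertices can be chosen
  independently, whence the product.\<close>

lemma card_graph_embeddings:
  assumes fin: "finite Vb" "finite Vw" "finite Es"
    and bv: "\<And>e. e \<in> Es \<Longrightarrow> bv e \<in> Vb" "\<And>e v. e \<in> Es \<Longrightarrow> v \<in> Vb \<Longrightarrow> incb e v \<longleftrightarrow> v = bv e"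
    and wv: "\<And>e. e \<in> Es \<Longrightarrow> wv e \<in> Vw" "\<And>e u. e \<in> Es \<Longrightarrow> u \<in> Vw \<Longrightarrow> incw e u \<longleftrightarrow> u = wv e"
    and surj: "wv ` Es = Vw"
  shows "card (graph_embeddings Vb Vw Es incb incw \<nu>) =
    (\<Sum>r\<in>Vb \<rightarrow>\<^sub>E rows \<nu>. \<Prod>u\<in>Vw. card {j. \<forall>e\<in>Es. wv e = u \<longrightarrow> (r (bv e), j) \<in> boxes \<nu>})"
proof -
  \<comment> \<open>The columns that remain admissible for \<open>u\<close> after the rows
    \<open>r\<close> have been fixed.\<close>
  define C where "C r u = {j. \<forall>e\<in>Es. wv e = u \<longrightarrow> (r (bv e), j) \<in> boxes \<nu>}" for r u
  define h where "h = (\<lambda>(r :: _ \<Rightarrow> nat, c :: _ \<Rightarrow> nat). (r, c, \<lambda>e\<in>Es. (r (bv e), c (wv e))))"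
  let ?D = "Sigma (Vb \<rightarrow>\<^sub>E rows \<nu>) (\<lambda>r. \<Pi>\<^sub>E u\<in>Vw. C r u)"
  have "inj_on h ?D" by (auto simp: h_def inj_on_def)
  moreover have "h ` ?D = graph_embeddings Vb Vw Es incb incw \<nu>"
  proof
    have "h (r, c) \<in> graph_embeddings Vb Vw Es incb incw \<nu>"
      if r: "r \<in> Vb \<rightarrow>\<^sub>E rows \<nu>" and c: "c \<in> (\<Pi>\<^sub>E u\<in>Vw. C r u)" for r c
    proof -
      have box: "(r (bv e), c (wv e)) \<in> boxes \<nu>" if "e \<in> Es" for e
        using c wv(1)[OF that] that by (auto simp: C_def PiE_def Pi_def)
      \<comment> \<open>The box of an edge at \<open>u\<close> witnesses that \<open>c u\<close> is
        a column of the diagram.\<close>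
      have "c \<in> Vw \<rightarrow>\<^sub>E columns \<nu>"
      proof (rule PiE_I)
        fix u assume "u \<in> Vw"
        then obtain e where "e \<in> Es" "u = wv e" using surj by auto
        then show "c u \<in> columns \<nu>" using box unfolding columns_def by auto
      qed (use c in auto)
      with r box show ?thesis
        using bv wv by (auto simp: graph_embeddings_def h_def)
    qed
    then show "h ` ?D \<subseteq> graph_embeddings Vb Vw Es incb incw \<nu>" by auto
    show "graph_embeddings Vb Vw Es incb incw \<nu> \<subseteq> h ` ?D"
    proof
      fix t assume t: "t \<in> graph_embeddings Vb Vw Es incb incw \<nu>"
      obtain r c b where t_eq: "t = (r, c, b)" by (cases t)
      from t have rcb: "r \<in> Vb \<rightarrow>\<^sub>E rows \<nu>" "c \<in> Vw \<rightarrow>\<^sub>E columns \<nu>" "b \<in> Es \<rightarrow>\<^sub>E boxes \<nu>"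
          "\<forall>e\<in>Es. \<forall>v\<in>Vb. incb e v \<longrightarrow> fst (b e) = r v"
          "\<forall>e\<in>Es. \<forall>v\<in>Vw. incw e v \<longrightarrow> snd (b e) = c v"
        by (auto simp: graph_embeddings_def t_eq)
      have b: "b e = (r (bv e), c (wv e))" if "e \<in> Es" for e
        using rcb(4,5) bv wv that by (simp add: prod_eq_iff)
      have "b = (\<lambda>e\<in>Es. (r (bv e), c (wv e)))"
        using rcb(3) b by (auto simp: fun_eq_iff restrict_def PiE_def extensional_def)
      moreover have "c u \<in> C r u" if "u \<in> Vw" for u
        unfolding C_def using b rcb(3) by (auto simp: PiE_def Pi_def)
      then have "c \<in> (\<Pi>\<^sub>E u\<in>Vw. C r u)" using rcb(2) by (auto simp: PiE_def)
      ultimately show "t \<in> h ` ?D"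
        using rcb(1) by (auto simp: h_def t_eq intro!: image_eqI[of _ _ "(r, c)"])
    qed
  qed
  ultimately have "card (graph_embeddings Vb Vw Es incb incw \<nu>) = card ?D"
    using card_image by metis
  also have "\<dots> = (\<Sum>r\<in>Vb \<rightarrow>\<^sub>E rows \<nu>. card (\<Pi>\<^sub>E u\<in>Vw. C r u))"
  proof (rule card_SigmaI)
    show "finite (Vb \<rightarrow>\<^sub>E rows \<nu>)" using fin by (auto intro: finite_PiE simp: rows_def)
    \<comment> \<open>An isolated \<open>u\<close> would admit every natural number. An edge at
      \<open>u\<close> bounds the admissible columns by the length of a row.\<close>
    have "finite (C r u)" if "u \<in> Vw" for r u
    proof -
      obtain e where "e \<in> Es" "u = wv e" using surj \<open>u \<in> Vw\<close> by blast
      then have "C r u \<subseteq> {..<\<nu> ! r (bv e)}" by (auto simp: C_def boxes_def)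
      then show ?thesis by (rule finite_subset) simp
    qed
    then show "\<forall>r\<in>Vb \<rightarrow>\<^sub>E rows \<nu>. finite (\<Pi>\<^sub>E u\<in>Vw. C r u)"
      using fin by (auto intro: finite_PiE)
  qed
  finally show ?thesis using fin by (simp add: card_PiE C_def)
qed

text \<open>Group the functions \<open>r\<close> by their composite with \<open>b\<close>. The fibre
  over \<open>f\<close> is the product of the fibres of \<open>b\<close> over the values of
  \<open>f\<close>.\<close>

lemma sum_PiE_fibres:
  fixes g :: "('v \<Rightarrow> nat) \<Rightarrow> nat"
  assumes "finite V" "finite A" "finite K" "b ` A \<subseteq> K"
  shows "(\<Sum>r\<in>V \<rightarrow>\<^sub>E A. g (\<lambda>v\<in>V. b (r v)))
    = (\<Sum>f\<in>V \<rightarrow>\<^sub>E K. (\<Prod>v\<in>V. card {i \<in> A. b i = f v}) * g f)"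
proof -
  let ?h = "\<lambda>r. \<lambda>v\<in>V. b (r v)"
  have fin: "finite (V \<rightarrow>\<^sub>E A)" "finite (V \<rightarrow>\<^sub>E K)" using assms by (auto intro: finite_PiE)
  have im: "?h ` (V \<rightarrow>\<^sub>E A) \<subseteq> V \<rightarrow>\<^sub>E K" using assms(4) by (fastforce simp: PiE_def Pi_def)
  have "(\<Sum>r\<in>V \<rightarrow>\<^sub>E A. g (?h r)) = (\<Sum>f\<in>V \<rightarrow>\<^sub>E K. \<Sum>r | r \<in> V \<rightarrow>\<^sub>E A \<and> ?h r = f. g (?h r))"
    using sum.group[OF fin im, of "\<lambda>r. g (?h r)"] by simp
  also have "\<dots> = (\<Sum>f\<in>V \<rightarrow>\<^sub>E K. card {r \<in> V \<rightarrow>\<^sub>E A. ?h r = f} * g f)"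
    by (intro sum.cong refl) simp
  also have "\<dots> = (\<Sum>f\<in>V \<rightarrow>\<^sub>E K. (\<Prod>v\<in>V. card {i \<in> A. b i = f v}) * g f)"
  proof (intro sum.cong refl)
    fix f assume f: "f \<in> V \<rightarrow>\<^sub>E K"
    have "{r \<in> V \<rightarrow>\<^sub>E A. ?h r = f} = (\<Pi>\<^sub>E v\<in>V. {i \<in> A. b i = f v})"
      using f by (fastforce simp: PiE_def Pi_def fun_eq_iff extensional_def)
    then show "card {r \<in> V \<rightarrow>\<^sub>E A. ?h r = f} * g f = (\<Prod>v\<in>V. card {i \<in> A. b i = f v}) * g f"
      using assms(1) by (simp add: card_PiE)
  qed
  finally show ?thesis .
qed

section \<open>Multirectangular diagrams and embeddings into them\<close>

text \<open>Lists, for every row of the diagram, the index of its block. Row lengths alone would not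
  tell apart blocks with equal entries of \<open>Q\<close>. Blocks of row length 0 are dropped, as
  in \<open>multirect\<close>.\<close>

definition multirect_blocks :: "nat list \<Rightarrow> nat list \<Rightarrow> nat list" where
  "multirect_blocks P Q =
     filter (\<lambda>k. 0 < Q ! k) (concat (map (\<lambda>k. replicate (P ! k) k) [0..<length Q]))"

lemma multirect_eq_map_blocks:
  assumes "length P = length Q"
  shows "multirect P Q = map ((!) Q) (multirect_blocks P Q)"
proof -
  have "map2 replicate P Q = map (\<lambda>k. replicate (P ! k) (Q ! k)) [0..<length Q]"
    using assms by (intro nth_equalityI) auto
  then show ?thesis
    by (simp add: multirect_def multirect_blocks_def filter_map map_concat filter_concat filter_replicate
        o_def if_distrib[of "map _"] cong: if_cong)
qed

lemma multirect_blocks_less: "k \<in> set (multirect_blocks P Q) \<Longrightarrow> k < length Q"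
  by (auto simp: multirect_blocks_def)

lemma length_filter_concat_replicate:
  "length (filter (\<lambda>j. j = k) (concat (map (\<lambda>k. replicate (p k) k) [0..<n]))) = (if k < n then p k else 0)"
  by (induction n) (auto simp: less_Suc_eq)

text \<open>If \<open>Q ! k\<close> were 0, the rows of block \<open>k\<close> would have been
  dropped and the count would be 0 instead of \<open>P ! k\<close>. In the count of embeddings such
  blocks occur only in vanishing summands.\<close>

lemma card_multirect_block:
  assumes "k < length Q" "0 < Q ! k"
  shows "card {i. i < length (multirect_blocks P Q) \<and> multirect_blocks P Q ! i = k} = P ! k"
proof -
  let ?L = "concat (map (\<lambda>k. replicate (P ! k) k) [0..<length Q])"
  have "filter (\<lambda>j. j = k) (multirect_blocks P Q) = filter (\<lambda>j. j = k) ?L"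
    unfolding multirect_blocks_def filter_filter by (rule filter_cong) (use assms in auto)
  then show ?thesis
    using assms(1) length_filter_concat_replicate[of k "(!) P" "length Q"]
      length_filter_conv_card[of "\<lambda>j. j = k" "multirect_blocks P Q"] by simp
qed

lemma sorted_multirect_blocks: "sorted (multirect_blocks P Q)"
proof -
  have "sorted (concat (map (\<lambda>k. replicate (P ! k) k) [0..<n]))" for n
    by (induction n) (auto simp: sorted_append less_imp_le)
  then show ?thesis
    unfolding multirect_blocks_def by (rule sorted_wrt_filter)
qed

text \<open>Block indices weakly increase down the rows and \<open>Q\<close> weakly decreases in the
  index.\<close>

lemma is_partition_multirect:
  assumes "length P = length Q" "sorted_wrt (\<ge>) Q"
  shows "is_partition (multirect P Q)"
proof -
  have anti: "Q ! j \<le> Q ! i" if "i \<le> j" "j < length Q" for i j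
    using assms(2) that by (cases "i = j") (auto simp: sorted_wrt_iff_nth_less)
  have "sorted_wrt (\<lambda>i j. Q ! i \<ge> Q ! j) (multirect_blocks P Q)"
    by (rule sorted_wrt_mono_rel[OF _ sorted_multirect_blocks])
      (use anti multirect_blocks_less in blast)
  then show ?thesis
    using assms(1)
    by (auto simp: is_partition_def multirect_eq_map_blocks sorted_wrt_map multirect_blocks_def)
qed

text \<open>The admissible columns for a white vertex are bounded by the shortest adjacent row, which
  lies in the adjacent block of largest index.\<close>

lemma card_graph_embeddings_multirect:
  assumes fin: "finite Vb" "finite Vw" "finite Es"
    and b1: "\<And>e. e \<in> Es \<Longrightarrow> \<exists>!v. v \<in> Vb \<and> incb e v"
    and w1: "\<And>e. e \<in> Es \<Longrightarrow> \<exists>!u. u \<in> Vw \<and> incw e u"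
    and b_surj: "\<And>v. v \<in> Vb \<Longrightarrow> \<exists>e\<in>Es. incb e v"
    and w_surj: "\<And>u. u \<in> Vw \<Longrightarrow> \<exists>e\<in>Es. incw e u"
    and PQ: "length P = l" "length Q = l" "sorted_wrt (\<ge>) Q"
  shows "card (graph_embeddings Vb Vw Es incb incw (multirect P Q)) =
    (\<Sum>f\<in>Vb \<rightarrow>\<^sub>E {..<l}. (\<Prod>v\<in>Vb. P ! f v) *
       (\<Prod>u\<in>Vw. Q ! Max (f ` {v \<in> Vb. \<exists>e\<in>Es. incb e v \<and> incw e u})))"
proof -
  define bv where "bv e = (THE v. v \<in> Vb \<and> incb e v)" for e
  define wv where "wv e = (THE u. u \<in> Vw \<and> incw e u)" for e
  have bvE: "bv e \<in> Vb \<and> incb e (bv e)" if "e \<in> Es" for e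
    unfolding bv_def by (rule theI'[OF b1[OF that]])
  have bv: "incb e v \<longleftrightarrow> v = bv e" if "e \<in> Es" "v \<in> Vb" for e v
    using bvE[OF that(1)] b1[OF that(1)] that(2) by auto
  have wvE: "wv e \<in> Vw \<and> incw e (wv e)" if "e \<in> Es" for e
    unfolding wv_def by (rule theI'[OF w1[OF that]])
  have wv: "incw e u \<longleftrightarrow> u = wv e" if "e \<in> Es" "u \<in> Vw" for e u
    using wvE[OF that(1)] w1[OF that(1)] that(2) by auto
  have wsurj: "wv ` Es = Vw"
    using w_surj wvE wv by (force simp: image_iff)
  define nb where "nb u = {v \<in> Vb. \<exists>e\<in>Es. incb e v \<and> incw e u}" for u
  have nb: "nb u = bv ` {e \<in> Es. wv e = u}" if "u \<in> Vw" for u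
    using that bv wv bvE unfolding nb_def by (auto simp: image_iff)
  define \<nu> where "\<nu> = multirect P Q"
  define L where "L = multirect_blocks P Q"
  have \<nu>: "\<nu> = map ((!) Q) L"
    unfolding \<nu>_def L_def by (rule multirect_eq_map_blocks) (use PQ in simp)
  have L: "L ! i < l" if "i < length L" for i
    using multirect_blocks_less[of "L ! i" P Q] that PQ by (simp add: L_def)
  have anti: "Q ! j \<le> Q ! i" if "i \<le> j" "j < l" for i j
    using PQ that by (cases "i = j") (auto simp: sorted_wrt_iff_nth_less)
  have rows: "rows \<nu> = {..<length L}" by (simp add: rows_def \<nu>)
  define g where "g f = (\<Prod>u\<in>Vw. Q ! Max (f ` nb u))" for f :: "_ \<Rightarrow> nat"
  have "card (graph_embeddings Vb Vw Es incb incw \<nu>) = (\<Sum>r\<in>Vb \<rightarrow>\<^sub>E {..<length L}.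
      \<Prod>u\<in>Vw. card {j. \<forall>e\<in>Es. wv e = u \<longrightarrow> (r (bv e), j) \<in> boxes \<nu>})"
    unfolding rows[symmetric]
    by (rule card_graph_embeddings) (use fin bvE bv wvE wv wsurj in auto)
  \<comment> \<open>The summand depends on \<open>r\<close> only through the blocks of the chosen
    rows, which prepares the grouping into fibres.\<close>
  also have "\<dots> = (\<Sum>r\<in>Vb \<rightarrow>\<^sub>E {..<length L}. g (\<lambda>v\<in>Vb. L ! r v))"
    unfolding g_def
  proof (intro sum.cong prod.cong refl)
    fix r u assume r: "r \<in> Vb \<rightarrow>\<^sub>E {..<length L}" and u: "u \<in> Vw"
    let ?f = "\<lambda>v\<in>Vb. L ! r v"
    let ?k = "Max (?f ` nb u)"
    have rl: "r v < length L" if "v \<in> Vb" for v using r that by auto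
    have nbV: "nb u \<subseteq> Vb" by (auto simp: nb_def)
    have fin_nb: "finite (?f ` nb u)" using nbV fin(1) by (auto intro: finite_subset)
    \<comment> \<open>Some edge ends in \<open>u\<close>, so the maximum is taken over a nonempty
      set and is attained.\<close>
    have "nb u \<noteq> {}" using wsurj u by (auto simp: nb)
    then have "?k \<in> ?f ` nb u" using fin_nb by (intro Max_in) auto
    then obtain v0 where v0: "v0 \<in> nb u" "?k = L ! r v0" using nbV by auto
    have "(\<forall>e\<in>Es. wv e = u \<longrightarrow> (r (bv e), j) \<in> boxes \<nu>) \<longleftrightarrow> j < Q ! ?k" for j
    proof -
      have "(\<forall>e\<in>Es. wv e = u \<longrightarrow> (r (bv e), j) \<in> boxes \<nu>) \<longleftrightarrow> (\<forall>v\<in>nb u. (r v, j) \<in> boxes \<nu>)"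
        by (auto simp: nb[OF u])
      also have "\<dots> \<longleftrightarrow> (\<forall>v\<in>nb u. j < Q ! (L ! r v))"
        using nbV rl by (auto simp: boxes_def \<nu>)
      also have "\<dots> \<longleftrightarrow> j < Q ! ?k"
      proof
        assume *: "j < Q ! ?k"
        show "\<forall>v\<in>nb u. j < Q ! (L ! r v)"
        proof
          fix v assume v: "v \<in> nb u"
          have "?f v \<le> ?k" using v fin_nb by (intro Max_ge) auto
          then have "L ! r v \<le> ?k" using v nbV by auto
          moreover have "?k < l" using v0 nbV rl L by auto
          ultimately show "j < Q ! (L ! r v)" using anti * less_le_trans by blast
        qed
      qed (use v0 in auto)
      finally show ?thesis .
    qed
    then have "{j. \<forall>e\<in>Es. wv e = u \<longrightarrow> (r (bv e), j) \<in> boxes \<nu>} = {..<Q ! ?k}" by auto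
    then show "card {j. \<forall>e\<in>Es. wv e = u \<longrightarrow> (r (bv e), j) \<in> boxes \<nu>} = Q ! ?k" by simp
  qed
  also have "\<dots> = (\<Sum>f\<in>Vb \<rightarrow>\<^sub>E {..<l}. (\<Prod>v\<in>Vb. card {i \<in> {..<length L}. L ! i = f v}) * g f)"
    by (rule sum_PiE_fibres) (use fin L in auto)
  also have "\<dots> = (\<Sum>f\<in>Vb \<rightarrow>\<^sub>E {..<l}. (\<Prod>v\<in>Vb. P ! f v) * g f)"
  proof (intro sum.cong refl)
    fix f assume f: "f \<in> Vb \<rightarrow>\<^sub>E {..<l}"
    show "(\<Prod>v\<in>Vb. card {i \<in> {..<length L}. L ! i = f v}) * g f = (\<Prod>v\<in>Vb. P ! f v) * g f"
    \<comment> \<open>Assignments with \<open>g f = 0\<close> contribute 0 on both sides. Otherwise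
      a black vertex \<open>v\<close> has a white neighbour \<open>u\<close>, and
      \<open>Q ! f v\<close> is at least the nonzero factor of \<open>u\<close> in
      \<open>g f\<close>, so the block \<open>f v\<close> has not been dropped.\<close>
    proof (cases "g f = 0")
      case False
      have "card {i \<in> {..<length L}. L ! i = f v} = P ! f v" if v: "v \<in> Vb" for v
      proof -
        obtain e where e: "e \<in> Es" "incb e v" using b_surj v by auto
        define u where "u = wv e"
        have u: "u \<in> Vw" "v \<in> nb u" using e v wvE by (auto simp: u_def nb_def)
        have fin_nb: "finite (f ` nb u)" using fin(1) by (auto simp: nb_def)
        have "f v \<le> Max (f ` nb u)" using u fin_nb by (intro Max_ge) auto
        moreover have "Max (f ` nb u) \<in> f ` nb u" using u fin_nb by (intro Max_in) auto
        then have "Max (f ` nb u) < l" using f by (auto simp: nb_def)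
        ultimately have "Q ! Max (f ` nb u) \<le> Q ! f v" by (rule anti)
        moreover have "Q ! Max (f ` nb u) \<noteq> 0" using False u(1) fin(2) by (auto simp: g_def)
        ultimately have "0 < Q ! f v" by simp
        moreover have "f v < length Q" using f v PQ by auto
        ultimately show ?thesis
          using card_multirect_block[of "f v" Q P] by (simp add: L_def)
      qed
      then show ?thesis by simp
    qed simp
  qed
  finally show ?thesis by (simp add: g_def nb_def \<nu>_def)
qed

text \<open>Vertices are polygons and incidence is inclusion, so the facts on pairs and polygons
  supply unique ends for edges and exclude isolated vertices.\<close>

lemma N_map_multirect:
  assumes "finite S" "pairing_on S B" "pairing_on S W" "pairing_on S E"
    and "length P = l" "length Q = l" "sorted_wrt (\<ge>) Q"
  shows "N_map (B, W, E) (multirect P Q) =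
    (\<Sum>f\<in>polygons B E \<rightarrow>\<^sub>E {..<l}. (\<Prod>v\<in>polygons B E. P ! f v) *
       (\<Prod>u\<in>polygons W E. Q ! Max (f ` {v \<in> polygons B E. \<exists>e\<in>E. e \<subseteq> v \<and> e \<subseteq> u})))"
  unfolding N_map_def black_vertices.simps white_vertices.simps edges.simps
proof (rule card_graph_embeddings_multirect)
  show "finite (polygons B E)" "finite (polygons W E)" "finite E"
    using assms finite_polygons finite_pairing_on by blast+
  show "\<exists>!v. v \<in> polygons B E \<and> e \<subseteq> v" "\<exists>!v. v \<in> polygons W E \<and> e \<subseteq> v" if "e \<in> E" for e
    using pair_in_unique_polygon[OF assms(4) that] by (simp_all add: polygons_commute[of _ E])
  show "\<exists>e\<in>E. e \<subseteq> v" if "v \<in> polygons B E" for v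
    using polygon_has_pair[OF assms(4,2)] that by (simp add: polygons_commute[of _ E])
  show "\<exists>e\<in>E. e \<subseteq> v" if "v \<in> polygons W E" for v
    using polygon_has_pair[OF assms(4,3)] that by (simp add: polygons_commute[of _ E])
qed (use assms in auto)

section \<open>The contribution of a single map\<close>

text \<open>The formula for \<open>N_map\<close> with the coordinates replaced by variables, times
  the weight in the variable \<open>VarG\<close>. All signs and powers of
  \<open>sqrt \<alpha>\<close> are left to the point of evaluation.\<close>

definition map_contribution ::
  "rat poly \<Rightarrow> nat \<Rightarrow> 's set set \<Rightarrow> 's set set \<Rightarrow> 's set set \<Rightarrow> (mvar \<Rightarrow> real) \<Rightarrow> real" where
  "map_contribution p l B W E x =
    (\<Sum>f\<in>polygons B E \<rightarrow>\<^sub>E {..<l}. (\<Prod>v\<in>polygons B E. x (VarP (f v))) *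
       (\<Prod>u\<in>polygons W E. x (VarQ (Max (f ` {v \<in> polygons B E. \<exists>e\<in>E. e \<subseteq> v \<and> e \<subseteq> u}))))) *
    poly (map_poly of_rat p) (x VarG)"

text \<open>Expanding the weight in powers of \<open>VarG\<close> leaves one monomial for every
  assignment \<open>f\<close> and exponent \<open>k\<close>, with coefficient
  \<open>coeff p k\<close>.\<close>

lemma nonneg_mpoly_fun_map_contribution:
  assumes S: "finite S" "pairing_on S B" "pairing_on S W" "pairing_on S E"
    and p: "\<And>i. 0 \<le> coeff p i"
  shows "nonneg_mpoly_fun (VarP ` {..<l} \<union> VarQ ` {..<l} \<union> {VarG}) (map_contribution p l B W E)"
proof -
  let ?V = "VarP ` {..<l} \<union> VarQ ` {..<l} \<union> {VarG}"
  let ?Vb = "polygons B E" and ?Vw = "polygons W E"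
  define nb where "nb u = {v \<in> ?Vb. \<exists>e\<in>E. e \<subseteq> v \<and> e \<subseteq> u}" for u
  have fin: "finite ?Vb" "finite ?Vw" using S finite_polygons by blast+
  define mon where "mon f k = (\<Sum>v\<in>?Vb. Poly_Mapping.single (VarP (f v)) (1 :: nat))
    + (\<Sum>u\<in>?Vw. Poly_Mapping.single (VarQ (Max (f ` nb u))) 1)
    + Poly_Mapping.single VarG k" for f :: "_ \<Rightarrow> nat" and k
  have keys: "Poly_Mapping.keys (mon f k) \<subseteq> ?V" if f: "f \<in> ?Vb \<rightarrow>\<^sub>E {..<l}" for f k
  proof -
    \<comment> \<open>The bound on the index of \<open>VarQ\<close> needs the maximum to be a value
      of \<open>f\<close>, hence \<open>nb u\<close> to be nonempty.\<close>
    have "Max (f ` nb u) < l" if u: "u \<in> ?Vw" for u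
    proof -
      obtain e where e: "e \<in> E" "e \<subseteq> u"
        using polygon_has_pair[OF S(4,3), of u] u polygons_commute[of W E] by auto
      then have "nb u \<noteq> {}"
        using pair_in_unique_polygon[OF S(4) e(1), of B] by (auto simp: nb_def polygons_commute[of _ E])
      then have "Max (f ` nb u) \<in> f ` nb u" using fin(1) by (intro Max_in) (auto simp: nb_def)
      then show ?thesis using f by (auto simp: nb_def)
    qed
    then have "Poly_Mapping.keys (\<Sum>u\<in>?Vw. Poly_Mapping.single (VarQ (Max (f ` nb u))) (1::nat)) \<subseteq> ?V"
      by (intro order.trans[OF keys_sum]) auto
    moreover have "Poly_Mapping.keys (\<Sum>v\<in>?Vb. Poly_Mapping.single (VarP (f v)) (1::nat)) \<subseteq> ?V"
      using f by (intro order.trans[OF keys_sum]) auto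
    moreover have "Poly_Mapping.keys (Poly_Mapping.single VarG k) \<subseteq> ?V" by auto
    ultimately show ?thesis
      unfolding mon_def by (intro order.trans[OF keys_add] Un_least)
  qed
  have "map_contribution p l B W E = (\<lambda>x. \<Sum>f\<in>?Vb \<rightarrow>\<^sub>E {..<l}. \<Sum>k\<le>degree p.
      of_rat (coeff p k) * monomial_eval x (mon f k))"
    by (rule ext) (simp add: map_contribution_def mon_def monomial_eval_add monomial_eval_sum fin
        poly_of_rat_altdef sum_product nb_def mult_ac, rule sum.swap)
  moreover have "nonneg_mpoly_fun ?V \<dots>"
    by (intro nonneg_mpoly_fun_sum nonneg_mpoly_fun_monomial p keys)
  ultimately show ?thesis by simp
qed

lemma map_contribution_rescaled_coords:
  assumes S: "finite S" "pairing_on S B" "pairing_on S W" "pairing_on S E"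
    and PQ: "length P = l" "length Q = l" "sorted_wrt (\<ge>) Q"
    and \<alpha>: "0 < \<alpha>" and p: "admissible_weight (B, W, E) p"
  shows "map_contribution p l B W E (rescaled_coords \<alpha> P Q) =
    (- 1) ^ card E * (- 1) ^ card (polygons B W) *
      ((- (1 / sqrt \<alpha>)) ^ card (polygons B E) * sqrt \<alpha> ^ card (polygons W E)
        * poly (map_poly of_rat p) ((1 - \<alpha>) / sqrt \<alpha>) * real (N_map (B, W, E) (multirect P Q)))"
proof -
  let ?b = "card (polygons B E)" and ?w = "card (polygons W E)"
  \<comment> \<open>The parity of the Euler characteristic, written with plus signs only, so that
    \<open>(- 1) ^ n\<close> splits into factors for edges, faces, black and white vertices.\<close>
  define n where "n = card E + card (polygons B W) + ?b + ?w"
  have "even n \<longleftrightarrow> even (euler_char (B, W, E))"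
    by (simp add: n_def euler_char_def) blast
  then have poly: "poly (map_poly of_rat p) (- ((1 - \<alpha>) / sqrt \<alpha>))
      = (- 1) ^ n * poly (map_poly of_rat p) ((1 - \<alpha>) / sqrt \<alpha>)"
    by (rule poly_weight_uminus[OF p])
  have prodP: "(\<Prod>v\<in>polygons B E. real (P ! f v) / sqrt \<alpha>)
      = (1 / sqrt \<alpha>) ^ ?b * real (\<Prod>v\<in>polygons B E. P ! f v)" for f
    by (simp add: prod_dividef power_one_over divide_simps)
  have prodQ: "(\<Prod>u\<in>polygons W E. - sqrt \<alpha> * real (Q ! k u))
      = (- sqrt \<alpha>) ^ ?w * real (\<Prod>u\<in>polygons W E. Q ! k u)" for k
    by (simp only: prod.distrib prod_constant of_nat_prod)
  have N: "(\<Sum>f\<in>polygons B E \<rightarrow>\<^sub>E {..<l}. (1 / sqrt \<alpha>) ^ ?b * real (\<Prod>v\<in>polygons B E. P ! f v) *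
       ((- sqrt \<alpha>) ^ ?w * real (\<Prod>u\<in>polygons W E.
          Q ! Max (f ` {v \<in> polygons B E. \<exists>e\<in>E. e \<subseteq> v \<and> e \<subseteq> u}))))
     = (1 / sqrt \<alpha>) ^ ?b * (- sqrt \<alpha>) ^ ?w * real (N_map (B, W, E) (multirect P Q))"
    unfolding N_map_multirect[OF S PQ] of_nat_sum of_nat_mult sum_distrib_left
    by (simp only: mult_ac)
  have sq: "(- 1) ^ n = (- 1 :: real) ^ card E * (- 1) ^ card (polygons B W) * (- 1) ^ ?b * (- 1) ^ ?w"
    by (simp only: n_def power_add)
  have neg: "(- (1 / sqrt \<alpha>)) ^ ?b = (- 1) ^ ?b * (1 / sqrt \<alpha>) ^ ?b"
      "(- sqrt \<alpha>) ^ ?w = (- 1) ^ ?w * sqrt \<alpha> ^ ?w"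
    by (rule power_minus)+
  \<comment> \<open>The white sign occurs twice, from the variables for \<open>Q\<close> and from
    the weight, and cancels. The black sign, coming from the weight alone, turns
    \<open>1 / sqrt \<alpha>\<close> into its negative.\<close>
  have one: "(- 1) ^ ?w * ((- 1) ^ ?w * y) = (y :: real)" for y
    by (simp add: mult.assoc[symmetric] power_add[symmetric])
  show ?thesis
    unfolding map_contribution_def rescaled_coords.simps prodP prodQ
    unfolding N poly
    unfolding sq neg
    by (simp only: mult_ac one)
qed

section \<open>The sum over all maps of a given face-type\<close>

theorem theorem6p2:
  fixes B W :: "nat list \<Rightarrow> 's set set"
    and w :: "'s pmap \<Rightarrow> rat poly"
    and \<pi> :: "nat list" and l :: nat
  assumes fixed_faces: "\<And>\<rho>. is_partition \<rho> \<Longrightarrow>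
      \<exists>S. finite S \<and> pairing_on S (B \<rho>) \<and> pairing_on S (W \<rho>) \<and> pairings_type (B \<rho>) (W \<rho>) = \<rho>"
    and weights: "\<And>M. is_map M \<Longrightarrow> admissible_weight M (w M)"
    and characters: "\<And>\<nu> \<rho> \<alpha>. is_partition \<nu> \<Longrightarrow> is_partition \<rho> \<Longrightarrow> 0 < \<alpha> \<Longrightarrow>
      jack_character \<alpha> \<rho> \<nu> = (- 1) ^ length \<rho> * weighted_map_sum w (B \<rho>) (W \<rho>) \<alpha> \<nu>"
    and "is_partition \<pi>"
  shows "\<exists>R :: mpoly_rat.
      (\<forall>m. 0 \<le> Poly_Mapping.lookup R m) \<and>
      mpoly_vars R \<subseteq> VarP ` {..<l} \<union> VarQ ` {..<l} \<union> {VarG} \<and>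
      (\<forall>P Q \<alpha>. length P = l \<longrightarrow> length Q = l \<longrightarrow> sorted_wrt (\<ge>) Q \<longrightarrow> 0 < \<alpha> \<longrightarrow>
        (- 1) ^ sum_list \<pi> * jack_character \<alpha> \<pi> (multirect P Q)
          = mpoly_eval (rescaled_coords \<alpha> P Q) R)"
proof -
  obtain S where S: "finite S" "pairing_on S (B \<pi>)" "pairing_on S (W \<pi>)"
    and type: "pairings_type (B \<pi>) (W \<pi>) = \<pi>"
    using fixed_faces[OF assms(4)] by blast
  have weight: "admissible_weight (B \<pi>, W \<pi>, E) (w (B \<pi>, W \<pi>, E))" if "pairing_on S E" for E
    using weights[of "(B \<pi>, W \<pi>, E)"] S that by auto
  \<comment> \<open>The type of the black and white pairings sums to the number of black pairs, and
    all pairings of \<open>S\<close> have the same number of pairs.\<close>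
  have size: "sum_list \<pi> = card E" if "pairing_on S E" for E
    using sum_list_pairings_type[OF S] type card_pairing_on[OF S(1,2)] card_pairing_on[OF S(1) that]
    by simp
  have len: "length \<pi> = card (polygons (B \<pi>) (W \<pi>))"
    using length_pairings_type[of "B \<pi>" "W \<pi>"] type by simp
  \<comment> \<open>Neither \<open>P\<close>, \<open>Q\<close> nor \<open>\<alpha>\<close> enters
    here, so one polynomial serves all of them.\<close>
  define F where "F = (\<lambda>x. \<Sum>E | pairing_on S E.
    map_contribution (w (B \<pi>, W \<pi>, E)) l (B \<pi>) (W \<pi>) E x)"
  have "nonneg_mpoly_fun (VarP ` {..<l} \<union> VarQ ` {..<l} \<union> {VarG}) F"
    unfolding F_def
    using nonneg_mpoly_fun_map_contribution[OF S] weight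
    by (intro nonneg_mpoly_fun_sum) (auto simp: admissible_weight_def)
  then obtain R :: mpoly_rat where R: "\<forall>m. 0 \<le> Poly_Mapping.lookup R m"
      "mpoly_vars R \<subseteq> VarP ` {..<l} \<union> VarQ ` {..<l} \<union> {VarG}" "\<forall>x. mpoly_eval x R = F x"
    unfolding nonneg_mpoly_fun_def by blast
  have "(- 1) ^ sum_list \<pi> * jack_character \<alpha> \<pi> (multirect P Q)
      = mpoly_eval (rescaled_coords \<alpha> P Q) R"
    if PQ: "length P = l" "length Q = l" "sorted_wrt (\<ge>) Q" and \<alpha>: "0 < \<alpha>" for P Q \<alpha>
  proof -
    have "is_partition (multirect P Q)" using is_partition_multirect PQ by simp
    then have "jack_character \<alpha> \<pi> (multirect P Q)
        = (- 1) ^ length \<pi> * weighted_map_sum w (B \<pi>) (W \<pi>) \<alpha> (multirect P Q)"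
      using characters assms(4) \<alpha> by blast
    moreover have "F (rescaled_coords \<alpha> P Q) = (- 1) ^ sum_list \<pi> *
        ((- 1) ^ length \<pi> * weighted_map_sum w (B \<pi>) (W \<pi>) \<alpha> (multirect P Q))"
      \<comment> \<open>Both sums now run over the pairings of \<open>S\<close>, and the global sign
        is moved into each summand, where its exponents are the numbers of edges and faces.\<close>
      unfolding F_def weighted_map_sum_def pairing_onD(1)[OF S(2)] sum_distrib_left
    proof (rule sum.cong)
      fix E assume "E \<in> {E. pairing_on S E}"
      then have E: "pairing_on S E" by simp
      show "map_contribution (w (B \<pi>, W \<pi>, E)) l (B \<pi>) (W \<pi>) E (rescaled_coords \<alpha> P Q) =
        (- 1) ^ sum_list \<pi> * ((- 1) ^ length \<pi> *
          ((- (1 / sqrt \<alpha>)) ^ card (black_vertices (B \<pi>, W \<pi>, E))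
           * sqrt \<alpha> ^ card (white_vertices (B \<pi>, W \<pi>, E))
           * poly (map_poly of_rat (w (B \<pi>, W \<pi>, E))) ((1 - \<alpha>) / sqrt \<alpha>)
           * real (N_map (B \<pi>, W \<pi>, E) (multirect P Q))))"
        unfolding map_contribution_rescaled_coords[OF S E PQ \<alpha> weight[OF E]] size[OF E] len
        by (simp only: black_vertices.simps white_vertices.simps mult.assoc)
    qed simp
    ultimately show ?thesis using R(3) by simp
  qed
  with R(1,2) show ?thesis by blast
qed

end
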